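(* Let $U$ be the $n$-component solution at the boundary $\partial\Omega$, let $\tilde A=\tilde A(U)$ be a real symmetric $n\times n$ matrix, let $T$ be a nonsingular matrix with $T^T\tilde A T=\Lambda=\mathrm{diag}(\lambda_i)$, and let $A^+=\sqrt{\Lambda^+}\,T^{-1}$ and $A^-=\sqrt{|\Lambda^-|}\,T^{-1}$ be the associated matrices defined in the context. Consider the boundary term $$U^T\tilde A U=(A^+U)^T(A^+U)-(A^-U)^T(A^-U),$$ the boundary condition $$BU-G=S^{-1}(A^--RA^+)U-G=0,\qquad\text{equivalently}\qquad (A^--RA^+)U-SG=0,$$ where $R$ is a matrix, $S$ a nonsingular scaling matrix and $G$ the external boundary data, and the lifting operator term $$L_C(\tilde\Sigma(BU-G))=L_C\big(2(A^-)^T((A^--RA^+)U-SG)\big),\qquad \tilde\Sigma=2(A^-)^TS.$$ 1. The boundary term augmented with strong nonlinear homogeneous ($G=0$) boundary conditions is positive semi-definite if the matrix $R$ is such that $$I-R^TR\ \ge\ 0.\tag{a}$$ 2. The boundary term augmented with strong nonlinear inhomogeneous ($G\neq 0$) boundary conditions is bounded by the data $G$ if the matrix $R$ satisfies (a) with strict inequality and the matrix $S$ is such that $$I-S^TS-(R^TS)^T(I-R^TR)^{-1}(R^TS)\ \ge\ 0,\qquad\text{where}\quad (I-R^TR)^{-1}=\sum_{k=0}^{\infty}(R^TR)^k.\tag{b}$$ 3. The boundary term augmented with weak nonlinear homogeneous ($G=0$) boundary conditions is positive semi-definite if the matrix $R$ satisfies (a). 4. The boundary term augmented with weak nonlinear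 inhomogeneous ($G\neq 0$) boundary conditions is bounded by the data $G$ if the matrix $R$ satisfies (a) with strict inequality and the matrix $S$ satisfies (b).
   Context: For a matrix $M$, $M\ge 0$ means that $M$ is positive semi-definite; strict inequality means positive definite. $I$ is an identity matrix of the appropriate size. Origin of the boundary term: one considers a nonlinear initial boundary value problem on a domain $\Omega$ with outward unit normal $(n_1,\dots,n_k)$ on $\partial\Omega$, whose energy rate (without viscous terms) is $\frac12\frac{d}{dt}\|U\|_P^2+\oint_{\partial\Omega}U^T\tilde A U\,ds=0$, where $\|U\|_P^2=\int_\Omega U^TPU\,d\Omega$, $P$ is a symmetric positive (semi-)definite time-independent matrix, and $\tilde A$ is the symmetric part of $n_iA_i(U)$ (summation over $i$), the $A_i$ being the coefficient matrices of the problem. An energy estimate is obtained if the surface term is bounded by external data; this is the sense of "bounded by the data $G$" (the term stands on the same side as the time derivative of the energy, so it is its possible negativity that must be controlled by $G$). Splitting: with $T$ nonsingular (the eigenvector matrix or another matrix diagonalizing $\tilde A$ by $T^T\tilde A T=\Lambda$), set $W=T^{-1}U$. $\Lambda^-$ is the negative part of $\Lambda$ and $\Lambda^+$ the positive part, with possible zero diagonal entries included in $\Lambda^+$; $W^-$ and $W^+$ are the corresponding components of $W$. Then $U^T\tilde A U=(W^+)^T\Lambda^+W^++(W^-)^T\Lambda^-W^-$. The matrices $A^\pm$ satisfy $A^+U=\sqrt{\Lambda^+}\,W^+$ and $A^-U=\sqrt{|\Lambda^-|}\,W^-$ (only the rows of $T^{-1}$ belonging to the respective part are used); $|\Lambda^-|=\mathrm{diag}(|\lambda_i|)$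 and square roots of diagonal matrices are taken entrywise. The matrices have compatible sizes and $\tilde A$, $T$, $\Lambda$ depend on $U$. Strong versus weak: "strong" imposition means that $U$ satisfies the boundary condition exactly, so the boundary term is $U^T\tilde A U$ with that condition inserted. "Weak" imposition means that the term $L_C(\tilde\Sigma(BU-G))$ is added to the left-hand side of the differential equation, where the lifting operator $L_C$ satisfies $\int_\Omega\phi^TL_C(\psi)\,d\Omega=\oint_{\partial\Omega}\phi^T\psi\,ds$ for smooth vector functions $\phi,\psi$; the augmented boundary term is then $U^T\tilde A U+2(A^-U)^T\big((A^--RA^+)U-SG\big)$. *)

theory Defs
  imports
    Complex_Main
    "Jordan_Normal_Form.Gauss_Jordan_Elimination"
    "Jordan_Normal_Form.DL_Submatrix"
begin

text \<open>
  Matrices and vectors are those of \<^theory>\<open>Jordan_Normal_Form.Matrix\<close>, because the sizes of the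
  blocks belonging to the negative and to the nonnegative diagonal entries depend on the state
  and may be zero.
\<close>

definition psd_mat :: "real mat \<Rightarrow> bool" where
  "psd_mat M \<longleftrightarrow> square_mat M \<and> M\<^sup>T = M \<and>
     (\<forall>x \<in> carrier_vec (dim_row M). x \<bullet> (M *\<^sub>v x) \<ge> 0)"

definition pd_mat :: "real mat \<Rightarrow> bool" where
  "pd_mat M \<longleftrightarrow> square_mat M \<and> M\<^sup>T = M \<and>
     (\<forall>x \<in> carrier_vec (dim_row M). x \<noteq> 0\<^sub>v (dim_row M) \<longrightarrow> x \<bullet> (M *\<^sub>v x) > 0)"

text \<open>Only meaningful for invertible matrices (unspecified otherwise).\<close>

definition inv_mat :: "real mat \<Rightarrow> real mat" where
  "inv_mat M = the (mat_inverse M)"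

text \<open>
  The diagonal of \<open>\<Lambda>\<close> is given by \<open>lam 0, \<dots>, lam (n - 1)\<close>, in no particular order.
  Zero entries are counted as belonging to \<open>\<Lambda>\<^sup>+\<close>.
\<close>

definition pos_indices :: "nat \<Rightarrow> (nat \<Rightarrow> real) \<Rightarrow> nat set" where
  "pos_indices n lam = {i. i < n \<and> 0 \<le> lam i}"

definition neg_indices :: "nat \<Rightarrow> (nat \<Rightarrow> real) \<Rightarrow> nat set" where
  "neg_indices n lam = {i. i < n \<and> lam i < 0}"

text \<open>
  \<open>A\<^sup>+ = \<surd>\<Lambda>\<^sup>+ T\<^sup>-\<^sup>1\<close> and \<open>A\<^sup>- = \<surd>\<bar>\<Lambda>\<^sup>-\<bar> T\<^sup>-\<^sup>1\<close>, with only the rows of \<open>T\<^sup>-\<^sup>1\<close> that belong to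
  the respective part; these matrices are in general not square.
\<close>

definition A_plus :: "nat \<Rightarrow> (nat \<Rightarrow> real) \<Rightarrow> real mat \<Rightarrow> real mat" where
  "A_plus n lam T = (let P = pos_indices n lam in
     submatrix (mat_diag n (\<lambda>i. sqrt (lam i))) P P * submatrix (inv_mat T) P UNIV)"

definition A_minus :: "nat \<Rightarrow> (nat \<Rightarrow> real) \<Rightarrow> real mat \<Rightarrow> real mat" where
  "A_minus n lam T = (let N = neg_indices n lam in
     submatrix (mat_diag n (\<lambda>i. sqrt \<bar>lam i\<bar>)) N N * submatrix (inv_mat T) N UNIV)"

definition boundary_term :: "real mat \<Rightarrow> real vec \<Rightarrow> real" where
  "boundary_term A U = U \<bullet> (A *\<^sub>v U)"

text \<open>The boundary condition is \<open>B U - G = 0\<close> with the following \<open>B\<close>.\<close>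

definition bc_mat :: "real mat \<Rightarrow> real mat \<Rightarrow> real mat \<Rightarrow> real mat \<Rightarrow> real mat" where
  "bc_mat Ap Am R S = inv_mat S * (Am - R * Ap)"

text \<open>The coefficient \<open>\<Sigma> = 2 (A\<^sup>-)\<^sup>T S\<close> of the lifting operator term.\<close>

definition penalty_mat :: "real mat \<Rightarrow> real mat \<Rightarrow> real mat" where
  "penalty_mat Am S = 2 \<cdot>\<^sub>m (Am\<^sup>T * S)"

text \<open>
  The lifting operator \<open>L\<close> is characterized by
  \<open>\<integral>\<^sub>\<Omega> \<phi>\<^sup>T L(\<psi>) d\<Omega> = \<integral>\<^sub>\<partial>\<^sub>\<Omega> \<phi>\<^sup>T \<psi> ds\<close>.  Adding \<open>L(\<Sigma> (B U - G))\<close> to the left-hand side of the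
  differential equation, multiplying by \<open>U\<^sup>T\<close> and integrating over \<open>\<Omega>\<close> hence adds
  \<open>U\<^sup>T \<Sigma> (B U - G)\<close> to the integrand \<open>U\<^sup>T A U\<close> of the surface integral in the energy rate.
\<close>

definition weak_boundary_term ::
  "real mat \<Rightarrow> real mat \<Rightarrow> real mat \<Rightarrow> real vec \<Rightarrow> real vec \<Rightarrow> real" where
  "weak_boundary_term A Sig B U G = boundary_term A U + U \<bullet> (Sig *\<^sub>v (B *\<^sub>v U - G))"

text \<open>
  The boundary term stands on the same side as the time derivative of the energy, so being
  bounded by the data means a lower bound: its integral over the boundary is then at least
  \<open>- \<integral>\<^sub>\<partial>\<^sub>\<Omega> G\<^sup>T G ds\<close>.  The constant is fixed to one, hence independent of all quantities involved.
  (A constant allowed to depend on \<open>R\<close> and \<open>S\<close> would exist for every \<open>S\<close>.)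
\<close>

definition bounded_by_data :: "real \<Rightarrow> real vec \<Rightarrow> bool" where
  "bounded_by_data b G \<longleftrightarrow> b \<ge> - (G \<bullet> G)"

definition cond_a_mat :: "real mat \<Rightarrow> real mat" where
  "cond_a_mat R = 1\<^sub>m (dim_col R) - R\<^sup>T * R"

definition cond_b_mat :: "real mat \<Rightarrow> real mat \<Rightarrow> real mat" where
  "cond_b_mat R S = 1\<^sub>m (dim_col S) - S\<^sup>T * S
     - (R\<^sup>T * S)\<^sup>T * inv_mat (cond_a_mat R) * (R\<^sup>T * S)"

end

theory Submission
  imports Defs "Jordan_Normal_Form.Determinant"
begin

text \<open>
  Write \<open>x = A\<^sup>+ U\<close>, \<open>y = A\<^sup>- U\<close> and \<open>w = R x + S G\<close>.  In the variables \<open>T\<^sup>-\<^sup>1 U\<close> the boundary term is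
  diagonal and equals \<open>\<bar>x\<bar>\<^sup>2 - \<bar>y\<bar>\<^sup>2\<close> (\<open>boundary_term_split\<close>): outgoing minus incoming energy.  The
  boundary condition says \<open>y = w\<close>, so strong imposition gives \<open>\<bar>x\<bar>\<^sup>2 - \<bar>w\<bar>\<^sup>2\<close>.  Weak imposition adds
  \<open>2 y\<^sup>T (y - w)\<close>, and \<open>\<bar>x\<bar>\<^sup>2 - \<bar>y\<bar>\<^sup>2 + 2 y\<^sup>T (y - w) = \<bar>x\<bar>\<^sup>2 - \<bar>w\<bar>\<^sup>2 + \<bar>y - w\<bar>\<^sup>2\<close>
  (\<open>weak_boundary_term_completed_square\<close>).  Hence in both cases it suffices to bound \<open>\<bar>w\<bar>\<^sup>2\<close> by
  \<open>\<bar>x\<bar>\<^sup>2 + \<bar>G\<bar>\<^sup>2\<close>.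

  For \<open>G = 0\<close> this is the contractivity of \<open>R\<close>, which says \<open>C = I - R\<^sup>T R \<ge> 0\<close>.  In general
  \<open>\<bar>x\<bar>\<^sup>2 + \<bar>G\<bar>\<^sup>2 - \<bar>w\<bar>\<^sup>2\<close> is a quadratic form in \<open>(x, G)\<close> whose block for \<open>x\<close> is \<open>C\<close>; it is
  nonnegative if \<open>C > 0\<close> and the Schur complement of \<open>C\<close>, which is \<open>cond_b_mat R S\<close>, is \<open>\<ge> 0\<close>
  (\<open>reflection_with_data_bound\<close>).

  All this happens at a single state \<open>U\<close>, so the nonlinear problem is treated like a linear
  one with the coefficients evaluated at \<open>U\<close>.

  That the inverse of \<open>C\<close> is a Neumann series (\<open>neumann_series_gram\<close>) follows by telescoping,
  once the powers of \<open>Q = R\<^sup>T R\<close> are known to tend to zero; positive definiteness of \<open>C\<close> yields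
  this through a monotone sequence, without eigenvalues (\<open>gram_pow_vec_tendsto_zero\<close>).
\<close>

section \<open>Quadratic forms and inverses of real matrices\<close>

lemma scalar_prod_self_eq_sum: "(v :: real vec) \<bullet> v = (\<Sum>i<dim_vec v. (v $ i)\<^sup>2)"
  by (simp add: scalar_prod_def power2_eq_square lessThan_atLeast0)

lemma scalar_prod_self_nonneg: "0 \<le> (v :: real vec) \<bullet> v"
  unfolding scalar_prod_self_eq_sum by (simp add: sum_nonneg)

lemma abs_entry_le_norm:
  assumes "i < dim_vec v"
  shows "\<bar>(v :: real vec) $ i\<bar> \<le> sqrt (v \<bullet> v)"
proof -
  have "(v $ i)\<^sup>2 \<le> v \<bullet> v"
    unfolding scalar_prod_self_eq_sum using assms
    by (intro member_le_sum[of i "{..<dim_vec v}" "\<lambda>i. (v $ i)\<^sup>2"]) auto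
  then show ?thesis
    using real_sqrt_le_mono[of "(v $ i)\<^sup>2"] by simp
qed

lemma minus_vec_eq_zero_iff:
  assumes v: "(v :: real vec) \<in> carrier_vec n" and w: "w \<in> carrier_vec n"
  shows "v - w = 0\<^sub>v n \<longleftrightarrow> v = w"
proof -
  have "v - w = 0\<^sub>v n \<longleftrightarrow> (\<forall>i<n. v $ i - w $ i = 0)"
    using v w by (auto simp: vec_eq_iff)
  then show ?thesis using v w by (auto simp: vec_eq_iff)
qed

lemma norm_minus_expand:
  assumes "(v :: real vec) \<in> carrier_vec n" "w \<in> carrier_vec n"
  shows "(v - w) \<bullet> (v - w) = v \<bullet> v - 2 * (v \<bullet> w) + w \<bullet> w"
  using assms
  by (simp add: minus_scalar_prod_distrib[of _ n] scalar_prod_minus_distrib[of _ n]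
      comm_scalar_prod[of w n v])

lemma norm_plus_expand:
  assumes "(v :: real vec) \<in> carrier_vec n" "w \<in> carrier_vec n"
  shows "(v + w) \<bullet> (v + w) = v \<bullet> v + 2 * (v \<bullet> w) + w \<bullet> w"
  using assms
  by (simp add: add_scalar_prod_distrib[of _ n] scalar_prod_add_distrib[of _ n]
      comm_scalar_prod[of w n v])

lemma scalar_prod_transpose:
  fixes M :: "real mat"
  assumes "M \<in> carrier_mat nr nc" "x \<in> carrier_vec nc" "y \<in> carrier_vec nr"
  shows "x \<bullet> (M\<^sup>T *\<^sub>v y) = (M *\<^sub>v x) \<bullet> y"
proof -
  have "x \<bullet> (M\<^sup>T *\<^sub>v y) = (M\<^sup>T *\<^sub>v y) \<bullet> x"
    using assms by (intro comm_scalar_prod[of _ nc]) auto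
  also have "\<dots> = y \<bullet> (M *\<^sub>v x)"
    by (rule transpose_vec_mult_scalar[OF assms])
  also have "\<dots> = (M *\<^sub>v x) \<bullet> y"
    using assms by (intro comm_scalar_prod[of _ nr]) auto
  finally show ?thesis .
qed

lemma invertible_mat_iff_Units:
  fixes M :: "real mat"
  assumes M: "M \<in> carrier_mat n n"
  shows "invertible_mat M \<longleftrightarrow> M \<in> Units (ring_mat TYPE(real) n ())"
proof
  assume "invertible_mat M"
  then obtain B where B: "M * B = 1\<^sub>m n" "B * M = 1\<^sub>m (dim_row B)"
    using M unfolding invertible_mat_def inverts_mat_def by auto
  from arg_cong[OF B(1), of dim_col] arg_cong[OF B(2), of dim_col] M
  have "B \<in> carrier_mat n n" by auto
  with B M show "M \<in> Units (ring_mat TYPE(real) n ())"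
    by (auto simp: Units_def ring_mat_simps)
next
  assume "M \<in> Units (ring_mat TYPE(real) n ())"
  then show "invertible_mat M"
    using M by (auto simp: Units_def ring_mat_simps invertible_mat_def inverts_mat_def)
qed

lemma inv_mat_inverse:
  assumes M: "M \<in> carrier_mat n n" and inv: "invertible_mat M"
  shows "inv_mat M \<in> carrier_mat n n" "M * inv_mat M = 1\<^sub>m n" "inv_mat M * M = 1\<^sub>m n"
proof -
  obtain B where "mat_inverse M = Some B"
    using mat_inverse(1)[OF M, of "()"] inv invertible_mat_iff_Units[OF M] by auto
  with mat_inverse(2)[OF M this]
  show "inv_mat M \<in> carrier_mat n n" "M * inv_mat M = 1\<^sub>m n" "inv_mat M * M = 1\<^sub>m n"
    by (auto simp: inv_mat_def)
qed

lemma inv_mat_mult_vec: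
  assumes M: "M \<in> carrier_mat n n" "invertible_mat M" and v: "v \<in> carrier_vec n"
  shows "inv_mat M *\<^sub>v v \<in> carrier_vec n" "M *\<^sub>v (inv_mat M *\<^sub>v v) = v"
    "inv_mat M *\<^sub>v (M *\<^sub>v v) = v"
  using inv_mat_inverse[OF M] M(1) v
  by (auto simp flip: assoc_mult_mat_vec[of _ n n _ n])

lemma pd_mat_invertible:
  assumes M: "M \<in> carrier_mat n n" and pd: "pd_mat M"
  shows "invertible_mat M"
proof -
  have "v = 0\<^sub>v n" if "v \<in> carrier_vec n" "M *\<^sub>v v = 0\<^sub>v n" for v
  proof (rule ccontr)
    assume "v \<noteq> 0\<^sub>v n"
    with pd M that have "v \<bullet> (M *\<^sub>v v) > 0" unfolding pd_mat_def by auto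
    with that show False by simp
  qed
  then have "det M \<noteq> 0" using det_0_iff_vec_prod_zero_field[OF M] by blast
  then show ?thesis
    using det_non_zero_imp_unit[OF M, of "()"] invertible_mat_iff_Units[OF M] by blast
qed

lemma pd_imp_psd_mat: "pd_mat M \<Longrightarrow> psd_mat M"
proof -
  assume pd: "pd_mat M"
  have "x \<bullet> (M *\<^sub>v x) \<ge> 0" if "x \<in> carrier_vec (dim_row M)" for x
  proof (cases "x = 0\<^sub>v (dim_row M)")
    case True
    have "M *\<^sub>v x \<in> carrier_vec (dim_row M)" by (simp add: carrier_vecI)
    then show ?thesis using True by (simp add: scalar_prod_def)
  next
    case False
    then show ?thesis using pd that unfolding pd_mat_def by (auto intro: less_imp_le)
  qed
  with pd show ?thesis by (auto simp: pd_mat_def psd_mat_def)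
qed

section \<open>Reflection with an incoming signal\<close>

lemma cond_a_mat_carrier: "R \<in> carrier_mat m p \<Longrightarrow> cond_a_mat R \<in> carrier_mat p p"
  unfolding cond_a_mat_def by auto

lemma cond_a_mat_mult_vec:
  assumes "R \<in> carrier_mat m p" "x \<in> carrier_vec p"
  shows "cond_a_mat R *\<^sub>v x = x - (R\<^sup>T * R) *\<^sub>v x"
  using assms unfolding cond_a_mat_def
  by (simp add: minus_mult_distrib_mat_vec[of _ p p])

lemma cond_a_mat_form:
  assumes R: "R \<in> carrier_mat m p" and x: "x \<in> carrier_vec p" and y: "y \<in> carrier_vec p"
  shows "x \<bullet> (cond_a_mat R *\<^sub>v y) = x \<bullet> y - (R *\<^sub>v x) \<bullet> (R *\<^sub>v y)"
proof -
  have "(R\<^sup>T * R) *\<^sub>v y = R\<^sup>T *\<^sub>v (R *\<^sub>v y)"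
    using R y by (intro assoc_mult_mat_vec[of _ p m _ p]) auto
  moreover have "R *\<^sub>v y \<in> carrier_vec m" "R\<^sup>T *\<^sub>v (R *\<^sub>v y) \<in> carrier_vec p"
    using R y by auto
  ultimately show ?thesis
    unfolding cond_a_mat_mult_vec[OF R y]
    using x y scalar_prod_transpose[OF R x, of "R *\<^sub>v y"]
    by (simp add: scalar_prod_minus_distrib[of _ p])
qed

lemma reflection_contractive:
  assumes R: "R \<in> carrier_mat m p" and psd: "psd_mat (cond_a_mat R)"
    and x: "x \<in> carrier_vec p"
  shows "(R *\<^sub>v x) \<bullet> (R *\<^sub>v x) \<le> x \<bullet> x"
proof -
  have "x \<bullet> (cond_a_mat R *\<^sub>v x) \<ge> 0"
    using psd x cond_a_mat_carrier[OF R] unfolding psd_mat_def by auto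
  then show ?thesis unfolding cond_a_mat_form[OF R x x] by simp
qed

text \<open>
  Completing the square in \<open>x\<close>.  With \<open>C = I - R\<^sup>T R\<close> and \<open>z = C\<^sup>-\<^sup>1 R\<^sup>T S g\<close> the gap between the two
  sides is \<open>(x - z)\<^sup>T C (x - z)\<close> plus the quadratic form of the Schur complement of \<open>C\<close> at
  \<open>g\<close>, and that complement is \<open>cond_b_mat R S\<close>.
\<close>

lemma reflection_with_data_bound:
  assumes R: "R \<in> carrier_mat m p" and S: "S \<in> carrier_mat m q"
    and pd: "pd_mat (cond_a_mat R)" and psd: "psd_mat (cond_b_mat R S)"
    and x: "x \<in> carrier_vec p" and g: "g \<in> carrier_vec q"
  shows "(R *\<^sub>v x + S *\<^sub>v g) \<bullet> (R *\<^sub>v x + S *\<^sub>v g) \<le> x \<bullet> x + g \<bullet> g"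
proof -
  define C where "C = cond_a_mat R"
  define s where "s = S *\<^sub>v g"
  define h where "h = R\<^sup>T *\<^sub>v s"
  define z where "z = inv_mat C *\<^sub>v h"
  have C: "C \<in> carrier_mat p p" unfolding C_def by (rule cond_a_mat_carrier[OF R])
  have invC: "invertible_mat C" using pd_mat_invertible[OF C] pd by (simp add: C_def)
  note iC = inv_mat_inverse(1)[OF C invC]
  have s: "s \<in> carrier_vec m" using S g unfolding s_def by auto
  have h: "h \<in> carrier_vec p" using R s unfolding h_def by auto
  have z: "z \<in> carrier_vec p" "C *\<^sub>v z = h"
    unfolding z_def using inv_mat_mult_vec[OF C invC h] by auto
  have Rx: "R *\<^sub>v x \<in> carrier_vec m" using R x by auto
  have xz: "x - z \<in> carrier_vec p" using x z by auto
  have form: "v \<bullet> (C *\<^sub>v w) = v \<bullet> w - (R *\<^sub>v v) \<bullet> (R *\<^sub>v w)"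
    if "v \<in> carrier_vec p" "w \<in> carrier_vec p" for v w
    unfolding C_def by (rule cond_a_mat_form[OF R that])
  \<comment> \<open>\<open>C\<close> is symmetric and \<open>C z = h\<close>, so the mixed terms of the square are \<open>x\<^sup>T h\<close>.\<close>
  have sym: "z \<bullet> (C *\<^sub>v x) = x \<bullet> h"
  proof -
    have "z \<bullet> (C *\<^sub>v x) = x \<bullet> (C *\<^sub>v z)"
      using R form[OF z(1) x] form[OF x z(1)] comm_scalar_prod[OF x z(1)]
        comm_scalar_prod[of "R *\<^sub>v x" m "R *\<^sub>v z"] Rx z(1) by auto
    then show ?thesis by (simp add: z(2))
  qed
  have cross: "x \<bullet> h = (R *\<^sub>v x) \<bullet> s"
    unfolding h_def by (rule scalar_prod_transpose[OF R x s])
  have "0 \<le> (x - z) \<bullet> (C *\<^sub>v (x - z))"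
    using pd_imp_psd_mat[OF pd] C xz unfolding psd_mat_def C_def[symmetric] by auto
  also have "C *\<^sub>v (x - z) = C *\<^sub>v x - h"
    using mult_minus_distrib_mat_vec[OF C x z(1)] z(2) by simp
  also have "(x - z) \<bullet> (C *\<^sub>v x - h) = x \<bullet> (C *\<^sub>v x) - 2 * (x \<bullet> h) + z \<bullet> h"
  proof -
    have Cx: "C *\<^sub>v x \<in> carrier_vec p" using C x by auto
    show ?thesis
      using x z(1) h Cx sym
      by (simp add: minus_scalar_prod_distrib[of _ p] scalar_prod_minus_distrib[of _ p])
  qed
  finally have square: "0 \<le> x \<bullet> x - (R *\<^sub>v x) \<bullet> (R *\<^sub>v x) - 2 * ((R *\<^sub>v x) \<bullet> s) + z \<bullet> h"
    unfolding form[OF x x] cross .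
  have "0 \<le> g \<bullet> (cond_b_mat R S *\<^sub>v g)"
    using psd g S R unfolding psd_mat_def cond_b_mat_def by auto
  also have "cond_b_mat R S *\<^sub>v g = g - S\<^sup>T *\<^sub>v s - (R\<^sup>T * S)\<^sup>T *\<^sub>v z"
  proof -
    have H: "R\<^sup>T * S \<in> carrier_mat p q" using R S by auto
    have "((R\<^sup>T * S)\<^sup>T * inv_mat C * (R\<^sup>T * S)) *\<^sub>v g = (R\<^sup>T * S)\<^sup>T *\<^sub>v (inv_mat C *\<^sub>v ((R\<^sup>T * S) *\<^sub>v g))"
    proof -
      have "(R\<^sup>T * S)\<^sup>T * inv_mat C \<in> carrier_mat q p" using H iC by auto
      from assoc_mult_mat_vec[OF this H g]
      have "((R\<^sup>T * S)\<^sup>T * inv_mat C * (R\<^sup>T * S)) *\<^sub>v g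
          = ((R\<^sup>T * S)\<^sup>T * inv_mat C) *\<^sub>v ((R\<^sup>T * S) *\<^sub>v g)" .
      also have "\<dots> = (R\<^sup>T * S)\<^sup>T *\<^sub>v (inv_mat C *\<^sub>v ((R\<^sup>T * S) *\<^sub>v g))"
        using H iC g by (intro assoc_mult_mat_vec[of _ q p _ p]) auto
      finally show ?thesis .
    qed
    also have "(R\<^sup>T * S) *\<^sub>v g = h"
      unfolding h_def s_def using R S g by (intro assoc_mult_mat_vec[of _ p m _ q]) auto
    finally have 1: "((R\<^sup>T * S)\<^sup>T * inv_mat C * (R\<^sup>T * S)) *\<^sub>v g = (R\<^sup>T * S)\<^sup>T *\<^sub>v z"
      by (simp add: z_def)
    have 2: "(S\<^sup>T * S) *\<^sub>v g = S\<^sup>T *\<^sub>v s"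
      unfolding s_def using S g by (intro assoc_mult_mat_vec[of _ q m _ q]) auto
    have c: "S\<^sup>T * S \<in> carrier_mat q q" "(R\<^sup>T * S)\<^sup>T * inv_mat C * (R\<^sup>T * S) \<in> carrier_mat q q"
      by (intro mult_carrier_mat[of _ q m] mult_carrier_mat[of _ q p] transpose_carrier_mat
          iC H S; simp add: S H)+
    have q: "dim_col S = q" "1\<^sub>m q - S\<^sup>T * S \<in> carrier_mat q q" using S minus_carrier_mat[OF c(1)] by auto
    have "cond_b_mat R S *\<^sub>v g
        = (1\<^sub>m q - S\<^sup>T * S) *\<^sub>v g - ((R\<^sup>T * S)\<^sup>T * inv_mat C * (R\<^sup>T * S)) *\<^sub>v g"
      unfolding cond_b_mat_def C_def[symmetric] q(1)
      by (rule minus_mult_distrib_mat_vec[OF q(2) c(2) g])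
    also have "(1\<^sub>m q - S\<^sup>T * S) *\<^sub>v g = g - (S\<^sup>T * S) *\<^sub>v g"
      unfolding minus_mult_distrib_mat_vec[OF one_carrier_mat c(1) g] using g by simp
    finally show ?thesis unfolding 1 2 .
  qed
  also have "g \<bullet> (g - S\<^sup>T *\<^sub>v s - (R\<^sup>T * S)\<^sup>T *\<^sub>v z) = g \<bullet> g - s \<bullet> s - z \<bullet> h"
  proof -
    have H: "R\<^sup>T * S \<in> carrier_mat p q" using R S by auto
    have "g \<bullet> ((R\<^sup>T * S)\<^sup>T *\<^sub>v z) = ((R\<^sup>T * S) *\<^sub>v g) \<bullet> z"
      by (rule scalar_prod_transpose[OF H g z(1)])
    also have "(R\<^sup>T * S) *\<^sub>v g = h"
      unfolding h_def s_def using R S g by (intro assoc_mult_mat_vec[of _ p m _ q]) auto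
    also have "h \<bullet> z = z \<bullet> h" by (rule comm_scalar_prod[OF h z(1)])
    finally have 1: "g \<bullet> ((R\<^sup>T * S)\<^sup>T *\<^sub>v z) = z \<bullet> h" .
    have 2: "g \<bullet> (S\<^sup>T *\<^sub>v s) = s \<bullet> s"
      using scalar_prod_transpose[OF S g s] by (simp add: s_def)
    have "S\<^sup>T *\<^sub>v s \<in> carrier_vec q" "(R\<^sup>T * S)\<^sup>T *\<^sub>v z \<in> carrier_vec q"
      using S s H z by auto
    with g 1 2 show ?thesis by (simp add: scalar_prod_minus_distrib[of _ q])
  qed
  finally have "0 \<le> g \<bullet> g - s \<bullet> s - z \<bullet> h" .
  with square show ?thesis
    unfolding s_def[symmetric] norm_plus_expand[OF Rx s] by linarith
qed

section \<open>The Neumann series\<close>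

lemma pow_mat_Suc_vec:
  assumes Q: "(Q :: real mat) \<in> carrier_mat n n" and v: "v \<in> carrier_vec n"
  shows "(Q ^\<^sub>m Suc k) *\<^sub>v v = (Q ^\<^sub>m k) *\<^sub>v (Q *\<^sub>v v)"
  using assms by (simp add: assoc_mult_mat_vec[of _ n n _ n])

lemma pow_mat_Suc_vec':
  assumes Q: "(Q :: real mat) \<in> carrier_mat n n" and v: "v \<in> carrier_vec n"
  shows "(Q ^\<^sub>m Suc k) *\<^sub>v v = Q *\<^sub>v ((Q ^\<^sub>m k) *\<^sub>v v)"
  using v
proof (induction k arbitrary: v)
  case 0
  then show ?case using Q by simp
next
  case (Suc k)
  then show ?case
    using Q by (metis pow_mat_Suc_vec mult_mat_vec_carrier)
qed

lemma scalar_prod_pow_mat_move: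
  assumes Q: "(Q :: real mat) \<in> carrier_mat n n" and sym: "Q\<^sup>T = Q"
    and v: "v \<in> carrier_vec n" and w: "w \<in> carrier_vec n"
  shows "v \<bullet> ((Q ^\<^sub>m (j + k)) *\<^sub>v w) = ((Q ^\<^sub>m j) *\<^sub>v v) \<bullet> ((Q ^\<^sub>m k) *\<^sub>v w)"
  using v
proof (induction j arbitrary: v)
  case 0
  then show ?case using Q by simp
next
  case (Suc j)
  have Qw: "(Q ^\<^sub>m (j + k)) *\<^sub>v w \<in> carrier_vec n"
    by (intro mult_mat_vec_carrier[of _ n n] pow_carrier_mat Q w)
  have Qv: "Q *\<^sub>v v \<in> carrier_vec n" using Q Suc.prems by auto
  have "v \<bullet> ((Q ^\<^sub>m (Suc j + k)) *\<^sub>v w) = v \<bullet> (Q\<^sup>T *\<^sub>v ((Q ^\<^sub>m (j + k)) *\<^sub>v w))"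
    using pow_mat_Suc_vec'[OF Q w, of "j + k"] sym by simp
  also have "\<dots> = (Q *\<^sub>v v) \<bullet> ((Q ^\<^sub>m (j + k)) *\<^sub>v w)"
    by (rule scalar_prod_transpose[OF Q Suc.prems Qw])
  also have "\<dots> = ((Q ^\<^sub>m j) *\<^sub>v (Q *\<^sub>v v)) \<bullet> ((Q ^\<^sub>m k) *\<^sub>v w)"
    by (rule Suc.IH[OF Qv])
  also have "(Q ^\<^sub>m j) *\<^sub>v (Q *\<^sub>v v) = (Q ^\<^sub>m Suc j) *\<^sub>v v"
    using pow_mat_Suc_vec[OF Q Suc.prems] by simp
  finally show ?case .
qed

text \<open>
  Put \<open>Q = R\<^sup>T R\<close> and \<open>w = (I - Q)\<^sup>-\<^sup>1 x\<close>.  The sequence \<open>b\<^sub>k = x\<^sup>T Q\<^sup>k w\<close> decreases, as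
  \<open>b\<^sub>k - b\<^sub>k\<^sub>+\<^sub>1 = x\<^sup>T Q\<^sup>k x\<close> is the squared norm of \<open>Q\<^sup>j x\<close> if \<open>k = 2 j\<close> and that of \<open>R Q\<^sup>j x\<close> if
  \<open>k = 2 j + 1\<close>.  It is bounded below by zero, as \<open>b\<^sub>2\<^sub>j\<close> is the quadratic form of \<open>I - Q\<close> at \<open>Q\<^sup>j w\<close>.
  So \<open>b\<close> converges and its steps, among them the squared norms of \<open>Q\<^sup>j x\<close>, tend to zero.
\<close>

lemma gram_pow_vec_tendsto_zero:
  assumes R: "R \<in> carrier_mat m p" and pd: "pd_mat (cond_a_mat R)"
    and x: "x \<in> carrier_vec p" and i: "i < p"
  shows "(\<lambda>k. (((R\<^sup>T * R) ^\<^sub>m k) *\<^sub>v x) $ i) \<longlonglongrightarrow> 0"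
proof -
  define Q where "Q = R\<^sup>T * R"
  define C where "C = cond_a_mat R"
  define w where "w = inv_mat C *\<^sub>v x"
  have Q: "Q \<in> carrier_mat p p" using R unfolding Q_def by auto
  have sym: "Q\<^sup>T = Q"
    unfolding Q_def using R transpose_mult[of "R\<^sup>T" p m R p] by simp
  have C: "C \<in> carrier_mat p p" unfolding C_def by (rule cond_a_mat_carrier[OF R])
  have invC: "invertible_mat C" using pd_mat_invertible[OF C] pd by (simp add: C_def)
  have w: "w \<in> carrier_vec p" "C *\<^sub>v w = x"
    unfolding w_def using inv_mat_mult_vec[OF C invC x] by auto
  have Cv: "C *\<^sub>v v = v - Q *\<^sub>v v" if "v \<in> carrier_vec p" for v
    unfolding C_def Q_def by (rule cond_a_mat_mult_vec[OF R that])
  have Qk: "(Q ^\<^sub>m k) *\<^sub>v v \<in> carrier_vec p" if "v \<in> carrier_vec p" for k v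
    by (intro mult_mat_vec_carrier[of _ p p] pow_carrier_mat Q that)
  have Qx: "(Q ^\<^sub>m k) *\<^sub>v x = (Q ^\<^sub>m k) *\<^sub>v w - (Q ^\<^sub>m Suc k) *\<^sub>v w" for k
  proof -
    have "(Q ^\<^sub>m k) *\<^sub>v x = (Q ^\<^sub>m k) *\<^sub>v (w - Q *\<^sub>v w)"
      using w Cv[OF w(1)] by simp
    also have "\<dots> = (Q ^\<^sub>m k) *\<^sub>v w - (Q ^\<^sub>m k) *\<^sub>v (Q *\<^sub>v w)"
      using Q w by (intro mult_minus_distrib_mat_vec[of _ p p]) auto
    finally show ?thesis unfolding pow_mat_Suc_vec[OF Q w(1)] .
  qed
  define b where "b k = x \<bullet> ((Q ^\<^sub>m k) *\<^sub>v w)" for k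
  have step: "b k - b (Suc k) = x \<bullet> ((Q ^\<^sub>m k) *\<^sub>v x)" for k
    unfolding b_def Qx[of k]
    by (rule scalar_prod_minus_distrib[OF x Qk[OF w(1)] Qk[OF w(1)], symmetric])
  have even_step: "b (k + k) - b (Suc (k + k)) = ((Q ^\<^sub>m k) *\<^sub>v x) \<bullet> ((Q ^\<^sub>m k) *\<^sub>v x)" for k
    unfolding step by (rule scalar_prod_pow_mat_move[OF Q sym x x])
  have step_nonneg: "b (Suc k) \<le> b k" for k
  proof (cases "even k")
    case True
    then obtain j where "k = j + j" by (metis evenE mult_2)
    with even_step[of j] scalar_prod_self_nonneg[of "(Q ^\<^sub>m j) *\<^sub>v x"] show ?thesis by simp
  next
    case False
    then obtain j where k: "k = j + Suc j" by (metis oddE mult_2 add_Suc_right Suc_eq_plus1)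
    let ?y = "(Q ^\<^sub>m j) *\<^sub>v x"
    have "b k - b (Suc k) = ?y \<bullet> (Q *\<^sub>v ?y)"
      unfolding step k scalar_prod_pow_mat_move[OF Q sym x x] pow_mat_Suc_vec'[OF Q x] ..
    also have "Q *\<^sub>v ?y = R\<^sup>T *\<^sub>v (R *\<^sub>v ?y)"
      unfolding Q_def[symmetric] using R Qk[OF x, of j]
      by (subst (1) Q_def, intro assoc_mult_mat_vec[of _ p m _ p]) auto
    also have "?y \<bullet> (R\<^sup>T *\<^sub>v (R *\<^sub>v ?y)) = (R *\<^sub>v ?y) \<bullet> (R *\<^sub>v ?y)"
      using R Qk[OF x, of j] by (intro scalar_prod_transpose[OF R]) auto
    finally show ?thesis using scalar_prod_self_nonneg[of "R *\<^sub>v ?y"] by simp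
  qed
  then have dec: "decseq b" by (rule decseq_SucI)
  have "b (k + k) \<ge> 0" for k
  proof -
    let ?v = "(Q ^\<^sub>m k) *\<^sub>v w"
    have "b (k + k) = ((Q ^\<^sub>m k) *\<^sub>v x) \<bullet> ?v"
      unfolding b_def by (rule scalar_prod_pow_mat_move[OF Q sym x w(1)])
    also have "(Q ^\<^sub>m k) *\<^sub>v x = C *\<^sub>v ?v"
      unfolding Qx Cv[OF Qk[OF w(1)]] pow_mat_Suc_vec'[OF Q w(1)] ..
    also have "(C *\<^sub>v ?v) \<bullet> ?v = ?v \<bullet> (C *\<^sub>v ?v)"
      using C Qk[OF w(1), of k] by (intro comm_scalar_prod[of _ p]) auto
    also have "\<dots> \<ge> 0"
      using pd_imp_psd_mat[OF pd] C Qk[OF w(1), of k]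
      unfolding psd_mat_def C_def[symmetric] by auto
    finally show ?thesis .
  qed
  then have "0 \<le> b k" for k
    using decseqD[OF dec, of k "k + k"] by (meson le_add1 order_trans)
  then obtain L where L: "b \<longlonglongrightarrow> L"
    using decseq_convergent[OF dec, of 0] by blast
  have "(\<lambda>k. b k - b (Suc k)) \<longlonglongrightarrow> L - L"
    by (intro tendsto_diff L LIMSEQ_Suc)
  then have "(\<lambda>k. b (k + k) - b (Suc (k + k))) \<longlonglongrightarrow> 0"
    using LIMSEQ_subseq_LIMSEQ[of "\<lambda>k. b k - b (Suc k)" 0 "\<lambda>k. k + k"]
    by (simp add: strict_mono_def o_def)
  then have norm_lim: "(\<lambda>k. sqrt (((Q ^\<^sub>m k) *\<^sub>v x) \<bullet> ((Q ^\<^sub>m k) *\<^sub>v x))) \<longlonglongrightarrow> 0"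
    unfolding even_step using tendsto_real_sqrt by fastforce
  have entry_le: "\<bar>((Q ^\<^sub>m k) *\<^sub>v x) $ i\<bar> \<le> sqrt (((Q ^\<^sub>m k) *\<^sub>v x) \<bullet> ((Q ^\<^sub>m k) *\<^sub>v x))" for k
    using abs_entry_le_norm[of i "(Q ^\<^sub>m k) *\<^sub>v x"] carrier_vecD[OF Qk[OF x, of k]] i
    by metis
  have "(\<lambda>k. \<bar>((Q ^\<^sub>m k) *\<^sub>v x) $ i\<bar>) \<longlonglongrightarrow> 0"
    by (rule real_tendsto_sandwich[OF always_eventually always_eventually tendsto_const norm_lim])
      (rule allI, rule abs_ge_zero, rule allI, rule entry_le)
  then show ?thesis unfolding Q_def[symmetric] by (rule tendsto_rabs_zero_cancel)
qed

text \<open>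
  With \<open>w\<close> the \<open>j\<close>-th column of \<open>(I - Q)\<^sup>-\<^sup>1\<close>, the \<open>j\<close>-th column of \<open>Q\<^sup>k\<close> is \<open>Q\<^sup>k w - Q\<^sup>k\<^sup>+\<^sup>1 w\<close>, and the
  series telescopes.
\<close>

lemma neumann_series_gram:
  assumes R: "R \<in> carrier_mat m p" and pd: "pd_mat (cond_a_mat R)"
    and i: "i < p" and j: "j < p"
  shows "(\<lambda>k. ((R\<^sup>T * R) ^\<^sub>m k) $$ (i, j)) sums (inv_mat (cond_a_mat R) $$ (i, j))"
proof -
  define Q where "Q = R\<^sup>T * R"
  define C where "C = cond_a_mat R"
  define w where "w = inv_mat C *\<^sub>v unit_vec p j"
  have Q: "Q \<in> carrier_mat p p" using R unfolding Q_def by auto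
  have C: "C \<in> carrier_mat p p" unfolding C_def by (rule cond_a_mat_carrier[OF R])
  have invC: "invertible_mat C" using pd_mat_invertible[OF C] pd by (simp add: C_def)
  have w: "w \<in> carrier_vec p" "C *\<^sub>v w = unit_vec p j"
    unfolding w_def using inv_mat_mult_vec[OF C invC, of "unit_vec p j"] by auto
  have entry: "(M *\<^sub>v unit_vec p j) $ i = M $$ (i, j)" if "M \<in> carrier_mat p p" for M :: "real mat"
  proof -
    have "row M i \<in> carrier_vec p" using that i by auto
    then have "row M i \<bullet> unit_vec p j = row M i $ j" using j by simp
    then show ?thesis using that i j by simp
  qed
  define f where "f k = ((Q ^\<^sub>m k) *\<^sub>v w) $ i" for k
  have term_eq: "(Q ^\<^sub>m k) $$ (i, j) = f k - f (Suc k)" for k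
  proof -
    have "unit_vec p j = w - Q *\<^sub>v w"
      using cond_a_mat_mult_vec[OF R w(1)] w(2) unfolding C_def Q_def by simp
    then have "(Q ^\<^sub>m k) $$ (i, j) = ((Q ^\<^sub>m k) *\<^sub>v (w - Q *\<^sub>v w)) $ i"
      using entry[of "Q ^\<^sub>m k"] Q by simp
    also have "(Q ^\<^sub>m k) *\<^sub>v (w - Q *\<^sub>v w) = (Q ^\<^sub>m k) *\<^sub>v w - (Q ^\<^sub>m k) *\<^sub>v (Q *\<^sub>v w)"
      using Q w by (intro mult_minus_distrib_mat_vec[of _ p p]) auto
    also have "(Q ^\<^sub>m k) *\<^sub>v (Q *\<^sub>v w) = (Q ^\<^sub>m Suc k) *\<^sub>v w"
      by (rule pow_mat_Suc_vec[OF Q w(1), symmetric])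
    finally show ?thesis
      using Q i unfolding f_def by (simp del: pow_mat.simps)
  qed
  have "f \<longlonglongrightarrow> 0"
    unfolding f_def Q_def by (rule gram_pow_vec_tendsto_zero[OF R pd w(1) i])
  from telescope_sums'[OF this] have "(\<lambda>k. (Q ^\<^sub>m k) $$ (i, j)) sums f 0"
    unfolding term_eq by simp
  also have "f 0 = inv_mat C $$ (i, j)"
    using entry[OF inv_mat_inverse(1)[OF C invC]] Q w(1) unfolding f_def w_def by simp
  finally show ?thesis unfolding Q_def C_def .
qed

section \<open>Splitting the boundary term\<close>

lemma bij_betw_pick:
  assumes "finite I"
  shows "bij_betw (pick I) {..<card I} I"
proof -
  have mono: "strict_mono_on {..<card I} (pick I)"
    by (auto simp: strict_mono_on_def intro: pick_mono)
  then have inj: "inj_on (pick I) {..<card I}" by (rule strict_mono_on_imp_inj_on)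
  have "pick I ` {..<card I} \<subseteq> I" by (auto intro: pick_in_set)
  moreover have "card (pick I ` {..<card I}) = card I" using card_image[OF inj] by simp
  ultimately have "pick I ` {..<card I} = I" using assms card_subset_eq by blast
  with inj show ?thesis by (simp add: bij_betw_def)
qed

text \<open>
  Both \<open>A\<^sup>+\<close> and \<open>A\<^sup>-\<close> have this form.  Their rows are renumbered by \<open>pick\<close>, a bijection onto the
  index set, so the squared norm becomes a sum over the original indices.
\<close>

lemma scaled_rows:
  fixes M :: "real mat" and f :: "nat \<Rightarrow> real"
  assumes M: "M \<in> carrier_mat n n" and I: "I \<subseteq> {..<n}" and U: "U \<in> carrier_vec n"
  defines "D \<equiv> submatrix (mat_diag n f) I I * submatrix M I UNIV"
  shows "D \<in> carrier_mat (card I) n"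
    "(D *\<^sub>v U) \<bullet> (D *\<^sub>v U) = (\<Sum>i\<in>I. (f i * (M *\<^sub>v U) $ i)\<^sup>2)"
proof -
  have fin: "finite I" using I finite_subset by blast
  have II: "{i. i < n \<and> i \<in> I} = I" using I by auto
  have pick_less: "pick I k < n" if "k < card I" for k
    using pick_in_set[of k I] that I by auto
  have inj: "pick I k = pick I l \<longleftrightarrow> k = l" if "k < card I" "l < card I" for k l
    using bij_betw_pick[OF fin] that unfolding bij_betw_def inj_on_def by auto
  have 1: "submatrix (mat_diag n f) I I = mat_diag (card I) (\<lambda>k. f (pick I k))"
    unfolding submatrix_def
    by (rule eq_matI) (auto simp: mat_diag_def II pick_less inj)
  have 2: "submatrix M I UNIV = mat (card I) n (\<lambda>(k, j). M $$ (pick I k, j))"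
    unfolding submatrix_def using M by (auto simp: II pick_UNIV)
  have D: "D = mat (card I) n (\<lambda>(k, j). f (pick I k) * M $$ (pick I k, j))"
    unfolding D_def 1 2 by (subst mat_diag_mult_left[of _ _ n]) auto
  then show "D \<in> carrier_mat (card I) n" by simp
  have entry: "(D *\<^sub>v U) $ k = f (pick I k) * (M *\<^sub>v U) $ pick I k" if "k < card I" for k
    using that M U pick_less[OF that] unfolding D
    by (simp add: scalar_prod_def sum_distrib_left mult.assoc)
  have "(D *\<^sub>v U) \<bullet> (D *\<^sub>v U) = (\<Sum>k<card I. (f (pick I k) * (M *\<^sub>v U) $ pick I k)\<^sup>2)"
    unfolding scalar_prod_self_eq_sum using entry by (simp add: D)
  also have "\<dots> = (\<Sum>i\<in>I. (f i * (M *\<^sub>v U) $ i)\<^sup>2)"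
    by (rule sum.reindex_bij_betw[OF bij_betw_pick[OF fin]])
  finally show "(D *\<^sub>v U) \<bullet> (D *\<^sub>v U) = (\<Sum>i\<in>I. (f i * (M *\<^sub>v U) $ i)\<^sup>2)" .
qed

lemma A_plus_carrier:
  assumes "T \<in> carrier_mat n n" "invertible_mat T"
  shows "A_plus n lam T \<in> carrier_mat (card (pos_indices n lam)) n"
  unfolding A_plus_def Let_def
  by (rule scaled_rows(1)[OF inv_mat_inverse(1)[OF assms] _ zero_carrier_vec])
    (auto simp: pos_indices_def)

lemma A_minus_carrier:
  assumes "T \<in> carrier_mat n n" "invertible_mat T"
  shows "A_minus n lam T \<in> carrier_mat (card (neg_indices n lam)) n"
  unfolding A_minus_def Let_def
  by (rule scaled_rows(1)[OF inv_mat_inverse(1)[OF assms] _ zero_carrier_vec])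
    (auto simp: neg_indices_def)

text \<open>
  Inserting \<open>U = T W\<close> turns the form into \<open>\<Sum>\<^sub>i \<lambda>\<^sub>i W\<^sub>i\<^sup>2\<close>; the terms with \<open>\<lambda>\<^sub>i \<ge> 0\<close> and those with
  \<open>\<lambda>\<^sub>i < 0\<close> are, up to sign, the squared norms of the two scaled parts of \<open>W\<close>.
\<close>

lemma boundary_term_split:
  assumes U: "U \<in> carrier_vec n" and A: "A \<in> carrier_mat n n"
    and T: "T \<in> carrier_mat n n" "invertible_mat T"
    and diag: "T\<^sup>T * A * T = mat_diag n lam"
  shows "boundary_term A U = (A_plus n lam T *\<^sub>v U) \<bullet> (A_plus n lam T *\<^sub>v U)
    - (A_minus n lam T *\<^sub>v U) \<bullet> (A_minus n lam T *\<^sub>v U)"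
proof -
  define W where "W = inv_mat T *\<^sub>v U"
  have W: "W \<in> carrier_vec n" "T *\<^sub>v W = U"
    unfolding W_def using inv_mat_mult_vec[OF T U] by auto
  note iT = inv_mat_inverse(1)[OF T]
  have AU: "A *\<^sub>v U \<in> carrier_vec n" using A U by auto
  have "boundary_term A U = (T *\<^sub>v W) \<bullet> (A *\<^sub>v U)"
    unfolding boundary_term_def W(2) ..
  also have "\<dots> = W \<bullet> (T\<^sup>T *\<^sub>v (A *\<^sub>v (T *\<^sub>v W)))"
    using scalar_prod_transpose[OF T(1) W(1) AU] by (simp add: W(2))
  also have "T\<^sup>T *\<^sub>v (A *\<^sub>v (T *\<^sub>v W)) = mat_diag n lam *\<^sub>v W"
  proof -
    have "T\<^sup>T * A \<in> carrier_mat n n" using T A by auto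
    from assoc_mult_mat_vec[OF this T(1) W(1)]
    have "mat_diag n lam *\<^sub>v W = (T\<^sup>T * A) *\<^sub>v (T *\<^sub>v W)" unfolding diag .
    also have "\<dots> = T\<^sup>T *\<^sub>v (A *\<^sub>v (T *\<^sub>v W))"
      using T A U W by (intro assoc_mult_mat_vec[of _ n n _ n]) auto
    finally show ?thesis ..
  qed
  also have "W \<bullet> (mat_diag n lam *\<^sub>v W) = (\<Sum>i<n. lam i * (W $ i)\<^sup>2)"
  proof -
    have "(mat_diag n lam *\<^sub>v W) $ i = lam i * W $ i" if "i < n" for i
    proof -
      have "(mat_diag n lam *\<^sub>v W) $ i = (\<Sum>j\<in>{0..<n}. (if i = j then lam j else 0) * W $ j)"
        using that W(1) by (simp add: mat_diag_def scalar_prod_def)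
      also have "\<dots> = (\<Sum>j\<in>{0..<n}. if i = j then lam j * W $ j else 0)"
        by (intro sum.cong) auto
      finally have "(mat_diag n lam *\<^sub>v W) $ i = \<dots>" .
      then show ?thesis using that by simp
    qed
    moreover have "dim_vec (mat_diag n lam *\<^sub>v W) = n" by (simp add: mat_diag_def)
    ultimately show ?thesis
      by (simp add: scalar_prod_def[of W] power2_eq_square lessThan_atLeast0 mult.left_commute)
  qed
  also have "\<dots> = (\<Sum>i\<in>pos_indices n lam. lam i * (W $ i)\<^sup>2)
      + (\<Sum>i\<in>neg_indices n lam. lam i * (W $ i)\<^sup>2)"
    by (subst sum.union_disjoint[symmetric])
      (auto simp: pos_indices_def neg_indices_def intro!: sum.cong)
  also have "(\<Sum>i\<in>pos_indices n lam. lam i * (W $ i)\<^sup>2)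
      = (A_plus n lam T *\<^sub>v U) \<bullet> (A_plus n lam T *\<^sub>v U)"
    unfolding A_plus_def Let_def
    by (subst scaled_rows(2)[OF iT _ U])
      (auto simp: pos_indices_def W_def power_mult_distrib intro!: sum.cong)
  also have "(\<Sum>i\<in>neg_indices n lam. lam i * (W $ i)\<^sup>2)
      = - ((A_minus n lam T *\<^sub>v U) \<bullet> (A_minus n lam T *\<^sub>v U))"
    unfolding A_minus_def Let_def
    by (subst scaled_rows(2)[OF iT _ U])
      (auto simp: neg_indices_def W_def power_mult_distrib sum_negf[symmetric] intro!: sum.cong)
  finally show ?thesis by simp
qed

section \<open>Boundary conditions\<close>

lemma bc_residual_scaled:
  assumes Ap: "Ap \<in> carrier_mat p n" and Am: "Am \<in> carrier_mat m n"
    and R: "R \<in> carrier_mat m p" and S: "S \<in> carrier_mat m m" "invertible_mat S"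
    and U: "U \<in> carrier_vec n" and G: "G \<in> carrier_vec m"
  shows "S *\<^sub>v (bc_mat Ap Am R S *\<^sub>v U - G) = (Am - R * Ap) *\<^sub>v U - S *\<^sub>v G"
proof -
  have D: "Am - R * Ap \<in> carrier_mat m n" using Am R Ap by auto
  have DU: "(Am - R * Ap) *\<^sub>v U \<in> carrier_vec m" using D U by auto
  have "bc_mat Ap Am R S *\<^sub>v U = inv_mat S *\<^sub>v ((Am - R * Ap) *\<^sub>v U)"
    unfolding bc_mat_def by (rule assoc_mult_mat_vec[OF inv_mat_inverse(1)[OF S] D U])
  with inv_mat_mult_vec[OF S DU] mult_minus_distrib_mat_vec[OF S(1) _ G] show ?thesis by simp
qed

lemma bc_mat_mult_vec_carrier:
  assumes "Ap \<in> carrier_mat p n" "Am \<in> carrier_mat m n"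
    "R \<in> carrier_mat m p" "S \<in> carrier_mat m m" "invertible_mat S" "U \<in> carrier_vec n"
  shows "bc_mat Ap Am R S *\<^sub>v U \<in> carrier_vec m"
  unfolding bc_mat_def using assms inv_mat_inverse(1)[OF assms(4,5)]
  by (intro mult_mat_vec_carrier[of _ m n]) auto

lemma bc_equivalent:
  assumes Ap: "Ap \<in> carrier_mat p n" and Am: "Am \<in> carrier_mat m n"
    and R: "R \<in> carrier_mat m p" and S: "S \<in> carrier_mat m m" "invertible_mat S"
    and U: "U \<in> carrier_vec n" and G: "G \<in> carrier_vec m"
  shows "bc_mat Ap Am R S *\<^sub>v U - G = 0\<^sub>v m \<longleftrightarrow> (Am - R * Ap) *\<^sub>v U - S *\<^sub>v G = 0\<^sub>v m"
proof -
  let ?r = "bc_mat Ap Am R S *\<^sub>v U - G"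
  have r: "?r \<in> carrier_vec m" using bc_mat_mult_vec_carrier[OF Ap Am R S U] G by auto
  have "?r = 0\<^sub>v m \<longleftrightarrow> S *\<^sub>v ?r = 0\<^sub>v m"
  proof
    assume "S *\<^sub>v ?r = 0\<^sub>v m"
    then have "?r = inv_mat S *\<^sub>v 0\<^sub>v m" using inv_mat_mult_vec(3)[OF S r] by simp
    also have "\<dots> = 0\<^sub>v m" using inv_mat_inverse(1)[OF S] by (intro eq_vecI) auto
    finally show "?r = 0\<^sub>v m" .
  next
    assume "?r = 0\<^sub>v m"
    then show "S *\<^sub>v ?r = 0\<^sub>v m" using S(1) by (simp only:) (intro eq_vecI, auto)
  qed
  then show ?thesis unfolding bc_residual_scaled[OF assms] .
qed

lemma penalty_residual:
  assumes Ap: "Ap \<in> carrier_mat p n" and Am: "Am \<in> carrier_mat m n"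
    and R: "R \<in> carrier_mat m p" and S: "S \<in> carrier_mat m m" "invertible_mat S"
    and U: "U \<in> carrier_vec n" and G: "G \<in> carrier_vec m"
  shows "penalty_mat Am S *\<^sub>v (bc_mat Ap Am R S *\<^sub>v U - G)
    = (2 \<cdot>\<^sub>m Am\<^sup>T) *\<^sub>v ((Am - R * Ap) *\<^sub>v U - S *\<^sub>v G)"
proof -
  let ?r = "bc_mat Ap Am R S *\<^sub>v U - G"
  have r: "?r \<in> carrier_vec m" using bc_mat_mult_vec_carrier[OF Ap Am R S U] G by auto
  have "penalty_mat Am S = (2 \<cdot>\<^sub>m Am\<^sup>T) * S"
    unfolding penalty_mat_def using Am S by (intro mult_smult_assoc_mat[symmetric]) auto
  also have "\<dots> *\<^sub>v ?r = (2 \<cdot>\<^sub>m Am\<^sup>T) *\<^sub>v (S *\<^sub>v ?r)"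
    using Am S r by (intro assoc_mult_mat_vec[of _ n m _ m]) auto
  finally show ?thesis unfolding bc_residual_scaled[OF assms] .
qed

lemma residual_eq_minus_target:
  fixes Ap Am R S :: "real mat"
  assumes Ap: "Ap \<in> carrier_mat p n" and Am: "Am \<in> carrier_mat m n"
    and R: "R \<in> carrier_mat m p" and S: "S \<in> carrier_mat m m"
    and U: "U \<in> carrier_vec n" and G: "G \<in> carrier_vec m"
  shows "(Am - R * Ap) *\<^sub>v U - S *\<^sub>v G = Am *\<^sub>v U - (R *\<^sub>v (Ap *\<^sub>v U) + S *\<^sub>v G)"
proof -
  have "(Am - R * Ap) *\<^sub>v U = Am *\<^sub>v U - (R * Ap) *\<^sub>v U"
    by (rule minus_mult_distrib_mat_vec[OF Am mult_carrier_mat[OF R Ap] U])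
  also have "(R * Ap) *\<^sub>v U = R *\<^sub>v (Ap *\<^sub>v U)"
    by (rule assoc_mult_mat_vec[OF R Ap U])
  finally have eq: "(Am - R * Ap) *\<^sub>v U = Am *\<^sub>v U - R *\<^sub>v (Ap *\<^sub>v U)" .
  show ?thesis unfolding eq by (rule eq_vecI) (use Am R S in auto)
qed

text \<open>
  The penalty replaces \<open>- \<bar>y\<bar>\<^sup>2\<close> by \<open>\<bar>y - w\<bar>\<^sup>2 - \<bar>w\<bar>\<^sup>2\<close>, where \<open>y = A\<^sup>- U\<close> and \<open>w = R A\<^sup>+ U + S G\<close> is the
  value that the boundary condition prescribes for \<open>y\<close>.  The factor \<open>2\<close> in the penalty is
  what turns the mixed terms into a perfect square.
\<close>

lemma weak_boundary_term_completed_square: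
  assumes Ap: "Ap \<in> carrier_mat p n" and Am: "Am \<in> carrier_mat m n"
    and R: "R \<in> carrier_mat m p" and S: "S \<in> carrier_mat m m" "invertible_mat S"
    and U: "U \<in> carrier_vec n" and G: "G \<in> carrier_vec m"
    and split: "boundary_term A U = (Ap *\<^sub>v U) \<bullet> (Ap *\<^sub>v U) - (Am *\<^sub>v U) \<bullet> (Am *\<^sub>v U)"
  defines "w \<equiv> R *\<^sub>v (Ap *\<^sub>v U) + S *\<^sub>v G"
  shows "weak_boundary_term A (penalty_mat Am S) (bc_mat Ap Am R S) U G
    = (Ap *\<^sub>v U) \<bullet> (Ap *\<^sub>v U) - w \<bullet> w + (Am *\<^sub>v U - w) \<bullet> (Am *\<^sub>v U - w)"
proof -
  let ?y = "Am *\<^sub>v U"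
  have y: "?y \<in> carrier_vec m" using Am U by auto
  have w: "w \<in> carrier_vec m" unfolding w_def using R S Ap U G by auto
  have r: "?y - w \<in> carrier_vec m" using y w by auto
  have "penalty_mat Am S *\<^sub>v (bc_mat Ap Am R S *\<^sub>v U - G) = (2 \<cdot>\<^sub>m Am)\<^sup>T *\<^sub>v (?y - w)"
    unfolding penalty_residual[OF Ap Am R S U G]
      residual_eq_minus_target[OF Ap Am R S(1) U G] w_def
    by (intro arg_cong2[of _ _ _ _ "(*\<^sub>v)"] eq_matI) auto
  moreover have "U \<bullet> ((2 \<cdot>\<^sub>m Am)\<^sup>T *\<^sub>v (?y - w)) = ((2 \<cdot>\<^sub>m Am) *\<^sub>v U) \<bullet> (?y - w)"
    using Am U r by (intro scalar_prod_transpose[of _ m n]) auto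
  moreover have "(2 \<cdot>\<^sub>m Am) *\<^sub>v U = 2 \<cdot>\<^sub>v ?y"
    using Am U by (intro eq_vecI) auto
  moreover have "(2 \<cdot>\<^sub>v ?y) \<bullet> (?y - w) = 2 * (?y \<bullet> ?y - ?y \<bullet> w)"
    using y w r by (simp add: scalar_prod_minus_distrib[of _ m])
  ultimately show ?thesis
    unfolding weak_boundary_term_def split norm_minus_expand[OF y w] by simp
qed

theorem lemma3p2:
  fixes n :: nat
    and A T R S :: "real vec \<Rightarrow> real mat"
    and lam :: "real vec \<Rightarrow> nat \<Rightarrow> real"
    and U :: "real vec"
  assumes U: "U \<in> carrier_vec n"
    and A: "A U \<in> carrier_mat n n" "(A U)\<^sup>T = A U"
    and T: "T U \<in> carrier_mat n n" "invertible_mat (T U)"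
    and diag: "(T U)\<^sup>T * A U * T U = mat_diag n (lam U)"
    and R: "R U \<in> carrier_mat (card (neg_indices n (lam U))) (card (pos_indices n (lam U)))"
    and S: "S U \<in> carrier_mat (card (neg_indices n (lam U))) (card (neg_indices n (lam U)))"
      "invertible_mat (S U)"
  shows "let p = card (pos_indices n (lam U)); m = card (neg_indices n (lam U));
             Ap = A_plus n (lam U) (T U); Am = A_minus n (lam U) (T U);
             B = bc_mat Ap Am (R U) (S U); Sig = penalty_mat Am (S U);
             Q = (R U)\<^sup>T * R U
         in
    \<comment> \<open>the identities in the setting\<close>
    boundary_term (A U) U = (Ap *\<^sub>v U) \<bullet> (Ap *\<^sub>v U) - (Am *\<^sub>v U) \<bullet> (Am *\<^sub>v U) \<and>
    (\<forall>G \<in> carrier_vec m.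
       (B *\<^sub>v U - G = 0\<^sub>v m \<longleftrightarrow> (Am - R U * Ap) *\<^sub>v U - S U *\<^sub>v G = 0\<^sub>v m) \<and>
       Sig *\<^sub>v (B *\<^sub>v U - G) = (2 \<cdot>\<^sub>m Am\<^sup>T) *\<^sub>v ((Am - R U * Ap) *\<^sub>v U - S U *\<^sub>v G)) \<and>
    (pd_mat (cond_a_mat (R U)) \<longrightarrow>
       invertible_mat (cond_a_mat (R U)) \<and>
       (\<forall>i < p. \<forall>j < p. (\<lambda>k. (Q ^\<^sub>m k) $$ (i, j)) sums (inv_mat (cond_a_mat (R U)) $$ (i, j)))) \<and>
    \<comment> \<open>strong, homogeneous\<close>
    (psd_mat (cond_a_mat (R U)) \<longrightarrow>
       B *\<^sub>v U - 0\<^sub>v m = 0\<^sub>v m \<longrightarrow> boundary_term (A U) U \<ge> 0) \<and>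
    \<comment> \<open>strong, inhomogeneous\<close>
    (pd_mat (cond_a_mat (R U)) \<and> psd_mat (cond_b_mat (R U) (S U)) \<longrightarrow>
       (\<forall>G \<in> carrier_vec m. B *\<^sub>v U - G = 0\<^sub>v m \<longrightarrow> bounded_by_data (boundary_term (A U) U) G)) \<and>
    \<comment> \<open>weak, homogeneous\<close>
    (psd_mat (cond_a_mat (R U)) \<longrightarrow>
       weak_boundary_term (A U) Sig B U (0\<^sub>v m) \<ge> 0) \<and>
    \<comment> \<open>weak, inhomogeneous\<close>
    (pd_mat (cond_a_mat (R U)) \<and> psd_mat (cond_b_mat (R U) (S U)) \<longrightarrow>
       (\<forall>G \<in> carrier_vec m. bounded_by_data (weak_boundary_term (A U) Sig B U G) G))"
proof -
  define Ap where "Ap = A_plus n (lam U) (T U)"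
  define Am where "Am = A_minus n (lam U) (T U)"
  define p where "p = card (pos_indices n (lam U))"
  define m where "m = card (neg_indices n (lam U))"
  note RU = R[folded p_def m_def] and SU = S[folded m_def]
  have Ap: "Ap \<in> carrier_mat p n" unfolding Ap_def p_def by (rule A_plus_carrier[OF T])
  have Am: "Am \<in> carrier_mat m n" unfolding Am_def m_def by (rule A_minus_carrier[OF T])
  have x: "Ap *\<^sub>v U \<in> carrier_vec p" using Ap U by auto
  have y: "Am *\<^sub>v U \<in> carrier_vec m" using Am U by auto
  have C: "cond_a_mat (R U) \<in> carrier_mat p p" by (rule cond_a_mat_carrier[OF RU])
  have split: "boundary_term (A U) U
      = (Ap *\<^sub>v U) \<bullet> (Ap *\<^sub>v U) - (Am *\<^sub>v U) \<bullet> (Am *\<^sub>v U)"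
    unfolding Ap_def Am_def by (rule boundary_term_split[OF U A(1) T diag])
  let ?B = "bc_mat Ap Am (R U) (S U)"
  let ?w = "\<lambda>G. R U *\<^sub>v (Ap *\<^sub>v U) + S U *\<^sub>v G"
  have zero: "(0\<^sub>v m :: real vec) \<in> carrier_vec m" by simp
  have strong: "Am *\<^sub>v U = ?w G" if "G \<in> carrier_vec m" "?B *\<^sub>v U - G = 0\<^sub>v m"
    for G :: "real vec"
  proof -
    have "?w G \<in> carrier_vec m" using RU SU that x by auto
    moreover have eq: "Am *\<^sub>v U - ?w G = 0\<^sub>v m"
      using that bc_equivalent[OF Ap Am RU SU U that(1)]
        residual_eq_minus_target[OF Ap Am RU SU(1) U that(1)] by simp
    ultimately show ?thesis using minus_vec_eq_zero_iff[OF y] by blast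
  qed
  have w_zero: "?w (0\<^sub>v m) = R U *\<^sub>v (Ap *\<^sub>v U)"
    using RU SU x by auto
  have weak: "weak_boundary_term (A U) (penalty_mat Am (S U)) ?B U G
      \<ge> (Ap *\<^sub>v U) \<bullet> (Ap *\<^sub>v U) - ?w G \<bullet> ?w G" if "G \<in> carrier_vec m" for G
    unfolding weak_boundary_term_completed_square[OF Ap Am RU SU U that split]
    using scalar_prod_self_nonneg by simp
  note homogeneous = reflection_contractive[OF RU _ x]
  note inhomogeneous = reflection_with_data_bound[OF RU SU(1) _ _ x]
  show ?thesis
    unfolding Let_def Ap_def[symmetric] Am_def[symmetric] p_def[symmetric] m_def[symmetric]
  proof (intro conjI ballI allI impI)
    show "boundary_term (A U) U = (Ap *\<^sub>v U) \<bullet> (Ap *\<^sub>v U) - (Am *\<^sub>v U) \<bullet> (Am *\<^sub>v U)"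
      by (rule split)
  next
    fix G :: "real vec" assume G: "G \<in> carrier_vec m"
    show "?B *\<^sub>v U - G = 0\<^sub>v m \<longleftrightarrow> (Am - R U * Ap) *\<^sub>v U - S U *\<^sub>v G = 0\<^sub>v m"
      by (rule bc_equivalent[OF Ap Am RU SU U G])
    show "penalty_mat Am (S U) *\<^sub>v (?B *\<^sub>v U - G)
        = (2 \<cdot>\<^sub>m Am\<^sup>T) *\<^sub>v ((Am - R U * Ap) *\<^sub>v U - S U *\<^sub>v G)"
      by (rule penalty_residual[OF Ap Am RU SU U G])
  next
    assume pd: "pd_mat (cond_a_mat (R U))"
    show "invertible_mat (cond_a_mat (R U))" by (rule pd_mat_invertible[OF C pd])
    fix i j assume "i < p" "j < p"
    then show "(\<lambda>k. (((R U)\<^sup>T * R U) ^\<^sub>m k) $$ (i, j)) sums (inv_mat (cond_a_mat (R U)) $$ (i, j))"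
      by (rule neumann_series_gram[OF RU pd])
  next
    assume psd: "psd_mat (cond_a_mat (R U))" and bc: "?B *\<^sub>v U - 0\<^sub>v m = 0\<^sub>v m"
    show "boundary_term (A U) U \<ge> 0"
      unfolding split strong[OF zero bc] w_zero using homogeneous[OF psd] by linarith
  next
    fix G :: "real vec" assume cond: "pd_mat (cond_a_mat (R U)) \<and> psd_mat (cond_b_mat (R U) (S U))"
      and G: "G \<in> carrier_vec m" "?B *\<^sub>v U - G = 0\<^sub>v m"
    show "bounded_by_data (boundary_term (A U) U) G"
      unfolding bounded_by_data_def split strong[OF G]
      using inhomogeneous[OF conjunct1[OF cond] conjunct2[OF cond] G(1)] by linarith
  next
    assume psd: "psd_mat (cond_a_mat (R U))"
    show "weak_boundary_term (A U) (penalty_mat Am (S U)) ?B U (0\<^sub>v m) \<ge> 0"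
      using homogeneous[OF psd] weak[OF zero] unfolding w_zero by linarith
  next
    fix G :: "real vec" assume cond: "pd_mat (cond_a_mat (R U)) \<and> psd_mat (cond_b_mat (R U) (S U))"
      and G: "G \<in> carrier_vec m"
    show "bounded_by_data (weak_boundary_term (A U) (penalty_mat Am (S U)) ?B U G) G"
      unfolding bounded_by_data_def
      using inhomogeneous[OF conjunct1[OF cond] conjunct2[OF cond] G] weak[OF G] by linarith
  qed
qed

end
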